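(* Let $\psi_{id,s,\omega_s}$ be a cluster symmetric map whose permutation is the identity. Let $F(\mathbf x)=\frac{T(\mathbf x)}{\mathbf x^{\mathbf d}}$ be a Laurent polynomial of type $\frac{\bm\eta}{\mathbf d}$ in $\mathbb Q[\mathbf x^{\pm}]^{\langle\psi_{id,s,\omega_s}\rangle}$. Then $$\frac{T(\mathbf x)}{x_s^{d_s}}\in\mathbb Q\Big[\tfrac{P_{\omega_s}(\mathbf x)+x_s^2}{x_s},\ x_i\ (i\ne s)\Big],$$ and the invariant Laurent polynomial ring of $\psi_{id,s,\omega_s}$ is the polynomial ring in $\frac{P_{\omega_s}(\mathbf x)+x_s^2}{x_s}$ and $x_i^{\pm}$ for all $i\ne s$, that is, $$\mathbb Q[\mathbf x^{\pm}]^{\langle\psi_{id,s,\omega_s}\rangle}=\mathbb Q\Big[\tfrac{P_{\omega_s}(\mathbf x)+x_s^2}{x_s},\ x_i^{\pm}\ (i\ne s)\Big].$$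
   Context: Fix $n\ge1$ and indeterminates $\mathbf x=(x_1,\dots,x_n)$; $\mathbf x^{\mathbf v}=\prod x_i^{v_i}$; $[a]_+=\max\{a,0\}$ componentwise. A seedlet at direction $s\in[1,n]$ is $\omega_s=(\mathbf b,r,Z)$ with $\mathbf b\in\mathbb Z^n$, $b_s=0$, $r\in\mathbb Z_{>0}$, and $Z(u)=\sum_{i=0}^r z_iu^i\in\mathbb Z_{\ge0}[u]$ with $z_0,z_r>0$. Its exchange polynomial is $P_{\omega_s}(\mathbf x)=\sum_{i=0}^r z_i\mathbf x^{i[\mathbf b]_++(r-i)[-\mathbf b]_+}$. The cluster symmetric map $\psi_{id,s,\omega_s}(\mathbf x)$ replaces $x_s$ by $P_{\omega_s}(\mathbf x)/x_s$ and fixes the other variables. $\mathbb Q[\mathbf x^{\pm}]^{G}=\{F\in\mathbb Q[\mathbf x^{\pm}]\mid F(g(\mathbf x))=F(\mathbf x)\ \forall g\in G\}$; $\langle\psi\rangle$ is the group generated by $\psi$. $F$ is of type $\frac{\bm\eta}{\mathbf d}$ if $F=T(\mathbf x)/\mathbf x^{\mathbf d}$ with $T\in\mathbb Q[\mathbf x]$, $\mathbf d\in\mathbb Z^n$, $x_i\nmid T$ for all $i$, and $\eta_i$ is the degree of $T$ in $x_i$. *)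

theory Defs
  imports
    "HOL-Library.Poly_Mapping"
    "HOL-Computational_Algebra.Polynomial_Factorial"
    "HOL-Algebra.Generated_Groups"
begin

text \<open>
  The variables are indexed by a finite type \<open>'n\<close>, so that \<open>n = CARD('n) \<ge> 1\<close> is arbitrary.
  The linear order on \<open>'n\<close> (the usual one on \<open>1, \<dots>, n\<close>) is used only because the
  library's instance of \<open>idom\<close> for \<open>\<Rightarrow>\<^sub>0\<close> asks for it.

  All rings below (polynomials, Laurent polynomials, the rings \<open>\<rat>[f\<^sub>1, f\<^sub>2, \<dots>]\<close>) are regarded as
  subrings of the field \<open>\<rat>(x)\<close> of rational functions, the common home of \<open>F(x)\<close> and of the
  result of substituting rational functions into \<open>F\<close>.
\<close>

type_synonym 'n mpoly = "('n \<Rightarrow>\<^sub>0 nat) \<Rightarrow>\<^sub>0 rat"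
type_synonym 'n ratfun = "'n mpoly fract"

definition MConst :: "rat \<Rightarrow> 'n::{finite,linorder} mpoly" where
  "MConst c = Poly_Mapping.single 0 c"

definition MVar :: "'n::{finite,linorder} \<Rightarrow> 'n mpoly" where
  "MVar i = Poly_Mapping.single (Poly_Mapping.single i 1) 1"

definition X :: "'n::{finite,linorder} \<Rightarrow> 'n ratfun" where
  "X i = to_fract (MVar i)"

definition mdegree :: "'n::{finite,linorder} mpoly \<Rightarrow> 'n \<Rightarrow> nat" where
  "mdegree T i = Max ((\<lambda>v. Poly_Mapping.lookup v i) ` Poly_Mapping.keys T)"

inductive_set adjoin :: "'n::{finite,linorder} ratfun set \<Rightarrow> 'n ratfun set"
  for S :: "'n::{finite,linorder} ratfun set" where
  adjoin_const: "to_fract (MConst c) \<in> adjoin S"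
| adjoin_gen: "f \<in> S \<Longrightarrow> f \<in> adjoin S"
| adjoin_add: "f \<in> adjoin S \<Longrightarrow> g \<in> adjoin S \<Longrightarrow> f + g \<in> adjoin S"
| adjoin_mult: "f \<in> adjoin S \<Longrightarrow> g \<in> adjoin S \<Longrightarrow> f * g \<in> adjoin S"

definition laurent_polys :: "'n::{finite,linorder} ratfun set" where
  "laurent_polys = adjoin (range X \<union> range (\<lambda>i. inverse (X i)))"

text \<open>Substitution of a tuple \<open>g\<close> of rational functions for the variables.\<close>

definition msubst :: "('n::{finite,linorder} \<Rightarrow> 'n ratfun) \<Rightarrow> 'n mpoly \<Rightarrow> 'n ratfun" where
  "msubst g p = (\<Sum>v\<in>Poly_Mapping.keys p. to_fract (MConst (Poly_Mapping.lookup p v))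
                     * (\<Prod>i\<in>UNIV. g i ^ Poly_Mapping.lookup v i))"

text \<open>
  \<open>F(g(x))\<close> for a rational function \<open>F\<close>. It is defined as soon as \<open>F\<close> has some representation
  \<open>a / b\<close> with \<open>b(g(x)) \<noteq> 0\<close>, and then it does not depend on that representation; for
  algebraically independent \<open>g\<close> it is defined for all \<open>F\<close>.
\<close>

definition rsubst :: "('n::{finite,linorder} \<Rightarrow> 'n ratfun) \<Rightarrow> 'n ratfun \<Rightarrow> 'n ratfun" where
  "rsubst g F = (THE q. \<exists>a b. F = Fract a b \<and> msubst g b \<noteq> 0 \<and> q = msubst g a / msubst g b)"

definition alg_independent :: "('n::{finite,linorder} \<Rightarrow> 'n ratfun) \<Rightarrow> bool" where
  "alg_independent g \<longleftrightarrow> (\<forall>p. msubst g p = 0 \<longrightarrow> p = 0)"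

definition rcomp :: "('n::{finite,linorder} \<Rightarrow> 'n ratfun) \<Rightarrow> ('n \<Rightarrow> 'n ratfun) \<Rightarrow> 'n \<Rightarrow> 'n ratfun" where
  "rcomp g h = (\<lambda>i. rsubst h (g i))"

text \<open>
  The group of birational maps \<open>x \<mapsto> g(x)\<close> (dominant rational maps, that is tuples with
  algebraically independent entries, having a dominant rational inverse), with product
  \<open>(g h)(x) = g(h(x))\<close>. The groups \<open>\<langle>\<psi>\<rangle>\<close> are taken inside it.
\<close>

definition birational_group :: "('n::{finite,linorder} \<Rightarrow> 'n ratfun) monoid" where
  "birational_group =
     \<lparr>carrier = {g. alg_independent g \<and>
                   (\<exists>h. alg_independent h \<and> rcomp g h = X \<and> rcomp h g = X)},
      mult = rcomp,
      one = X\<rparr>"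

definition invariant_ring :: "('n::{finite,linorder} \<Rightarrow> 'n ratfun) set \<Rightarrow> 'n ratfun set" where
  "invariant_ring G = {F \<in> laurent_polys. \<forall>g\<in>G. rsubst g F = F}"

text \<open>A Laurent polynomial \<open>F = T / x\<^sup>d\<close> of type \<open>\<eta> / d\<close>; here necessarily \<open>T \<noteq> 0\<close>.\<close>

definition of_type ::
  "'n::{finite,linorder} ratfun \<Rightarrow> 'n mpoly \<Rightarrow> ('n \<Rightarrow> nat) \<Rightarrow> ('n \<Rightarrow> int) \<Rightarrow> bool" where
  "of_type F T \<eta> d \<longleftrightarrow>
     F = to_fract T / (\<Prod>i\<in>UNIV. X i powi d i) \<and>
     (\<forall>i. \<not> MVar i dvd T) \<and>
     (\<forall>i. \<eta> i = mdegree T i)"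

record 'n seedlet =
  bvec :: "'n \<Rightarrow> int"
  rdeg :: nat
  Zpoly :: "nat poly"

definition seedlet_at :: "'n \<Rightarrow> 'n seedlet \<Rightarrow> bool" where
  "seedlet_at s \<omega> \<longleftrightarrow>
     bvec \<omega> s = 0 \<and> rdeg \<omega> > 0 \<and>
     degree (Zpoly \<omega>) \<le> rdeg \<omega> \<and> coeff (Zpoly \<omega>) 0 > 0 \<and> coeff (Zpoly \<omega>) (rdeg \<omega>) > 0"

text \<open>Below, \<open>nat a\<close> is \<open>[a]\<^sub>+ = max a 0\<close>, because \<open>nat\<close> sends negative integers to \<open>0\<close>.\<close>

definition exchange_poly :: "'n::{finite,linorder} seedlet \<Rightarrow> 'n mpoly" where
  "exchange_poly \<omega> =
     (\<Sum>i\<le>rdeg \<omega>. of_nat (coeff (Zpoly \<omega>) i) *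
        (\<Prod>j\<in>UNIV. MVar j ^ (i * nat (bvec \<omega> j) + (rdeg \<omega> - i) * nat (- bvec \<omega> j))))"

definition cluster_sym_map ::
  "'n::{finite,linorder} \<Rightarrow> 'n seedlet \<Rightarrow> 'n \<Rightarrow> 'n ratfun" where
  "cluster_sym_map s \<omega> = X(s := to_fract (exchange_poly \<omega>) / X s)"

text \<open>
  With \<open>y = (P + x\<^sub>s\<^sup>2) / x\<^sub>s\<close>, a ring \<open>\<rat>[y, x\<^sub>i\<^sup>\<plusminus> (i \<noteq> s)]\<close> is \<open>adjoin\<close> of the listed elements; that it is a
  polynomial ring in \<open>y\<close> and the \<open>x\<^sub>i\<^sup>\<plusminus>\<close> means in addition that the tuple \<open>X(s := y)\<close> is
  algebraically independent.
\<close>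

definition basic_invariant :: "'n::{finite,linorder} \<Rightarrow> 'n seedlet \<Rightarrow> 'n ratfun" where
  "basic_invariant s \<omega> = (to_fract (exchange_poly \<omega>) + X s ^ 2) / X s"

end

theory Submission
  imports Defs
begin

text \<open>
  Write \<open>F = \<Sum>\<^sub>k f\<^sub>k x\<^sub>s\<^sup>k\<close> with coefficients \<open>f\<^sub>k\<close> not involving \<open>x\<^sub>s\<close>. Since \<open>P\<close> does not involve \<open>x\<^sub>s\<close>
  either, the map \<open>x\<^sub>s \<mapsto> P / x\<^sub>s\<close> is an involution, and \<open>F\<close> is invariant iff \<open>f\<^sub>-\<^sub>k = f\<^sub>k P\<^sup>k\<close> for all
  \<open>k \<ge> 0\<close>. Subtracting \<open>f\<^sub>m y\<^sup>m\<close>, where \<open>y = x\<^sub>s + P / x\<^sub>s\<close>, then lowers the pole order \<open>m\<close> at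
  \<open>x\<^sub>s = 0\<close>, and an invariant without a pole there is free of \<open>x\<^sub>s\<close>.
  Algebraic independence is obtained by specialising \<open>x\<^sub>s\<close> to infinitely many values.
\<close>

section \<open>Evaluation of polynomials as a ring homomorphism\<close>

lemma sum_single_lookup:
  "(\<Sum>v\<in>Poly_Mapping.keys p. Poly_Mapping.single v (Poly_Mapping.lookup p v)) = p"
  by (rule poly_mapping_eqI)
    (simp add: lookup_sum lookup_single when_def in_keys_iff)

text \<open>A finitely supported map is the sum of its terms. This form of induction suits additive
  statements about polynomials as well as multiplicative ones about exponent vectors.\<close>

lemma poly_mapping_single_add_induct [case_names zero single add]:
  fixes p :: "'a \<Rightarrow>\<^sub>0 'b::comm_monoid_add"
  assumes "Q 0" and "\<And>v c. Q (Poly_Mapping.single v c)"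
    and "\<And>p q. Q p \<Longrightarrow> Q q \<Longrightarrow> Q (p + q)"
  shows "Q p"
proof -
  have "Q (\<Sum>v\<in>S. Poly_Mapping.single v (Poly_Mapping.lookup p v))" if "finite S" for S
    using that by induction (auto intro: assms)
  then show ?thesis
    by (metis finite_keys sum_single_lookup)
qed

context
  fixes g :: "'n::{finite,linorder} \<Rightarrow> 'n ratfun"
begin

text \<open>Cancellation may shrink the support of \<open>p + q\<close>. A common larger index set,
  on which the extra terms vanish, lets the sums for \<open>p\<close>, \<open>q\<close> and
  \<open>p + q\<close> be compared term by term.\<close>

lemma msubst_superset:
  assumes "finite S" "Poly_Mapping.keys p \<subseteq> S"
  shows "msubst g p = (\<Sum>v\<in>S. to_fract (MConst (Poly_Mapping.lookup p v))
                     * (\<Prod>i\<in>UNIV. g i ^ Poly_Mapping.lookup v i))"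
  unfolding msubst_def
  by (rule sum.mono_neutral_left) (use assms in \<open>auto simp: in_keys_iff MConst_def\<close>)

lemma msubst_0 [simp]: "msubst g 0 = 0"
  by (simp add: msubst_def)

lemma msubst_single:
  "msubst g (Poly_Mapping.single v c) = to_fract (MConst c) * (\<Prod>i\<in>UNIV. g i ^ Poly_Mapping.lookup v i)"
  by (cases "c = 0") (simp_all add: msubst_def MConst_def)

lemma msubst_add [simp]: "msubst g (p + q) = msubst g p + msubst g q"
proof -
  have *: "msubst g r = (\<Sum>v\<in>Poly_Mapping.keys p \<union> Poly_Mapping.keys q.
      to_fract (MConst (Poly_Mapping.lookup r v)) * (\<Prod>i\<in>UNIV. g i ^ Poly_Mapping.lookup v i))"
    if "Poly_Mapping.keys r \<subseteq> Poly_Mapping.keys p \<union> Poly_Mapping.keys q" for r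
    using that by (intro msubst_superset) auto
  show ?thesis
    using keys_add[of p q]
    by (simp add: * lookup_add MConst_def single_add sum.distrib distrib_right)
qed

text \<open>Both sides are additive in each factor, so only products of two monomials need a
  computation.\<close>

lemma msubst_mult [simp]: "msubst g (p * q) = msubst g p * msubst g q"
proof (induction p rule: poly_mapping_single_add_induct)
  case (single v c)
  show ?case
  proof (induction q rule: poly_mapping_single_add_induct)
    case (single w d)
    have "MConst (c * d) = (MConst c * MConst d :: 'n mpoly)"
      by (simp add: MConst_def mult_single)
    then show ?case
      by (simp add: mult_single msubst_single lookup_add power_add prod.distrib)
  qed (simp_all add: algebra_simps)
qed (simp_all add: algebra_simps)

lemma msubst_MConst [simp]: "msubst g (MConst c) = to_fract (MConst c)"
  by (simp add: MConst_def msubst_single)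

lemma msubst_MVar [simp]: "msubst g (MVar i) = g i"
proof -
  have "(\<Prod>j\<in>UNIV. g j ^ Poly_Mapping.lookup (Poly_Mapping.single i 1) j)
      = (\<Prod>j\<in>UNIV. if j = i then g j else 1)"
    by (intro prod.cong) (auto simp: lookup_single when_def)
  also have "\<dots> = g i"
    by simp
  finally show ?thesis
    by (simp add: MVar_def msubst_single MConst_def)
qed

lemma msubst_1 [simp]: "msubst g 1 = 1"
  using msubst_MConst[of 1] by (simp add: MConst_def)

lemma msubst_power [simp]: "msubst g (p ^ k) = msubst g p ^ k"
  by (induction k) simp_all

lemma msubst_prod: "msubst g (prod f S) = (\<Prod>i\<in>S. msubst g (f i))"
  by (induction S rule: infinite_finite_induct) simp_all

lemma msubst_sum: "msubst g (sum f S) = (\<Sum>i\<in>S. msubst g (f i))"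
  by (induction S rule: infinite_finite_induct) simp_all

lemma msubst_of_nat [simp]: "msubst g (of_nat k) = of_nat k"
  by (induction k) simp_all

end

section \<open>Polynomials inside the field of rational functions\<close>

lemma to_fract_power: "to_fract (a ^ k) = to_fract a ^ k"
  by (induction k) simp_all

lemma to_fract_prod: "to_fract (prod f S) = (\<Prod>i\<in>S. to_fract (f i))"
  by (induction S rule: infinite_finite_induct) simp_all

lemma to_fract_sum: "to_fract (sum f S) = (\<Sum>i\<in>S. to_fract (f i))"
  by (induction S rule: infinite_finite_induct) simp_all

lemma to_fract_of_nat: "to_fract (of_nat k) = of_nat k"
  by (induction k) simp_all

lemma of_nat_ratfun_eq_0_iff: "(of_nat k :: 'n::{finite,linorder} ratfun) = 0 \<longleftrightarrow> k = 0"
  by (metis of_nat_eq_0_iff to_fract_eq_0_iff to_fract_of_nat)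

text \<open>The rational constants already form an infinite subset. This is the source of
  contradiction whenever a nonzero univariate polynomial would have too many roots.\<close>

lemma infinite_ratfun: "infinite (UNIV :: 'n::{finite,linorder} ratfun set)"
proof -
  have "inj (\<lambda>c. to_fract (MConst c) :: 'n ratfun)"
    by (rule injI) (metis MConst_def lookup_single_eq to_fract_eq_iff)
  then show ?thesis
    by (metis finite_imageD infinite_UNIV_char_0 infinite_super subset_UNIV)
qed

lemma MVar_nonzero [simp]: "MVar i \<noteq> 0"
  by (metis MVar_def lookup_single_eq lookup_zero zero_neq_one)

lemma X_nonzero [simp]: "X i \<noteq> 0"
  by (simp add: X_def)

lemma single_single_1: "Poly_Mapping.single (Poly_Mapping.single i k) (1::rat) = MVar i ^ k"
proof (induction k)
  case (Suc k)
  have "Poly_Mapping.single (Poly_Mapping.single i (Suc k)) (1::rat)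
      = Poly_Mapping.single (Poly_Mapping.single i 1) 1 * Poly_Mapping.single (Poly_Mapping.single i k) 1"
    by (simp add: mult_single flip: single_add)
  with Suc show ?case
    by (simp add: MVar_def)
qed simp

lemma prod_MVar_power: "(\<Prod>i\<in>UNIV. MVar i ^ Poly_Mapping.lookup v i) = Poly_Mapping.single v 1"
proof (induction v rule: poly_mapping_single_add_induct)
  case (single j k)
  have "(\<Prod>i\<in>UNIV. MVar i ^ Poly_Mapping.lookup (Poly_Mapping.single j k) i)
      = (\<Prod>i\<in>UNIV. if i = j then MVar i ^ k else 1 :: 'a mpoly)"
    by (intro prod.cong) (auto simp: lookup_single when_def)
  then show ?case
    by (simp add: single_single_1)
next
  case (add v w)
  then show ?case
    by (simp add: lookup_add power_add prod.distrib mult_single)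
qed simp

lemma msubst_X [simp]: "msubst X p = to_fract p"
proof (induction p rule: poly_mapping_single_add_induct)
  case (single v c)
  have "to_fract (Poly_Mapping.single v c) = to_fract (MConst c * Poly_Mapping.single v 1)"
    by (simp add: MConst_def mult_single)
  also have "\<dots> = to_fract (MConst c) * (\<Prod>i\<in>UNIV. X i ^ Poly_Mapping.lookup v i)"
    by (simp add: X_def to_fract_prod to_fract_power flip: prod_MVar_power)
  finally show ?case
    by (simp add: msubst_single)
qed simp_all


section \<open>Substitution into rational functions\<close>

text \<open>Equal fractions satisfy \<open>a * b' = a' * b\<close>; applying the homomorphism
  \<open>msubst g\<close> and dividing by the nonzero denominators shows that the value does not
  depend on the representation.\<close>

lemma rsubst_Fract:
  assumes "msubst g b \<noteq> 0"
  shows "rsubst g (Fract a b) = msubst g a / msubst g b"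
  unfolding rsubst_def
proof (rule the_equality)
  show "\<exists>a' b'. Fract a b = Fract a' b' \<and> msubst g b' \<noteq> 0
      \<and> msubst g a / msubst g b = msubst g a' / msubst g b'"
    using assms by blast
next
  fix q
  assume "\<exists>a' b'. Fract a b = Fract a' b' \<and> msubst g b' \<noteq> 0 \<and> q = msubst g a' / msubst g b'"
  then obtain a' b' where *: "Fract a b = Fract a' b'" "msubst g b' \<noteq> 0" "q = msubst g a' / msubst g b'"
    by blast
  have "b \<noteq> 0" "b' \<noteq> 0"
    using assms * by auto
  with * have "msubst g (a * b') = msubst g (a' * b)"
    by (simp add: eq_fract)
  with assms *(2) show "q = msubst g a / msubst g b"
    unfolding *(3) by (simp add: frac_eq_eq)
qed

lemma rsubst_to_fract [simp]: "rsubst g (to_fract a) = msubst g a"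
  using rsubst_Fract[of g 1 a] by (simp add: to_fract_def)

lemma rsubst_X_var [simp]: "rsubst g (X i) = g i"
  by (simp add: X_def)

lemma rsubst_by_X [simp]: "rsubst X f = f"
proof (cases f rule: Fract_cases_nonzero)
  case (Fract a b)
  then show ?thesis
    by (simp add: rsubst_Fract) (simp add: to_fract_def)
next
  case 0
  then show ?thesis
    using rsubst_to_fract[of X 0] by simp
qed

context
  fixes g :: "'n::{finite,linorder} \<Rightarrow> 'n ratfun"
  assumes ind: "alg_independent g"
begin

lemma msubst_eq_0_iff: "msubst g p = 0 \<longleftrightarrow> p = 0"
  using ind by (auto simp: alg_independent_def)

text \<open>Algebraic independence keeps every nonzero denominator nonzero, so
  \<open>rsubst g\<close> is given by the expected quotient everywhere and becomes a field
  homomorphism.\<close>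

lemma rsubst_cases:
  obtains a b where "f = Fract a b" "b \<noteq> 0" "msubst g b \<noteq> 0" "rsubst g f = msubst g a / msubst g b"
  by (metis Fract_cases msubst_eq_0_iff rsubst_Fract)

lemma rsubst_add: "rsubst g (e + f) = rsubst g e + rsubst g f"
proof -
  obtain a b where e: "e = Fract a b" "b \<noteq> 0" "msubst g b \<noteq> 0" "rsubst g e = msubst g a / msubst g b"
    by (rule rsubst_cases)
  obtain c d where f: "f = Fract c d" "d \<noteq> 0" "msubst g d \<noteq> 0" "rsubst g f = msubst g c / msubst g d"
    by (rule rsubst_cases)
  have "e + f = Fract (a * d + c * b) (b * d)"
    using e f by simp
  with e f show ?thesis
    by (simp add: rsubst_Fract add_frac_eq)
qed

lemma rsubst_mult: "rsubst g (e * f) = rsubst g e * rsubst g f"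
proof -
  obtain a b where e: "e = Fract a b" "b \<noteq> 0" "msubst g b \<noteq> 0" "rsubst g e = msubst g a / msubst g b"
    by (rule rsubst_cases)
  obtain c d where f: "f = Fract c d" "d \<noteq> 0" "msubst g d \<noteq> 0" "rsubst g f = msubst g c / msubst g d"
    by (rule rsubst_cases)
  have "e * f = Fract (a * c) (b * d)"
    using e f by simp
  with e f show ?thesis
    by (simp add: rsubst_Fract)
qed

lemma rsubst_0: "rsubst g 0 = 0"
  using rsubst_to_fract[of g 0] by simp

lemma rsubst_1: "rsubst g 1 = 1"
  using rsubst_to_fract[of g 1] by simp

lemma rsubst_diff: "rsubst g (e - f) = rsubst g e - rsubst g f"
  using rsubst_add[of "e - f" f] by simp

lemma rsubst_inverse: "rsubst g (inverse f) = inverse (rsubst g f)"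
proof (cases "f = 0")
  case False
  then have "rsubst g (inverse f) * rsubst g f = 1"
    by (simp add: rsubst_1 flip: rsubst_mult)
  then show ?thesis
    by (metis inverse_unique mult.commute)
qed (simp add: rsubst_0)

lemma rsubst_divide: "rsubst g (e / f) = rsubst g e / rsubst g f"
  by (simp add: divide_inverse rsubst_mult rsubst_inverse)

lemma rsubst_power: "rsubst g (f ^ k) = rsubst g f ^ k"
  by (induction k) (simp_all add: rsubst_1 rsubst_mult)

lemma rsubst_powi: "rsubst g (f powi k) = rsubst g f powi k"
  by (simp add: power_int_def rsubst_power rsubst_inverse)

lemma rsubst_sum: "rsubst g (sum f S) = (\<Sum>i\<in>S. rsubst g (f i))"
  by (induction S rule: infinite_finite_induct) (simp_all add: rsubst_0 rsubst_add)

lemma rsubst_prod: "rsubst g (prod f S) = (\<Prod>i\<in>S. rsubst g (f i))"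
  by (induction S rule: infinite_finite_induct) (simp_all add: rsubst_1 rsubst_mult)

end

section \<open>Generated subrings and univariate polynomials over them\<close>

lemma adjoin_0 [simp]: "0 \<in> adjoin S"
  using adjoin_const[of 0 S] by (simp add: MConst_def)

lemma adjoin_1 [simp]: "1 \<in> adjoin S"
  using adjoin_const[of 1 S] by (simp add: MConst_def)

lemma adjoin_uminus: "f \<in> adjoin S \<Longrightarrow> - f \<in> adjoin S"
  using adjoin_mult[OF adjoin_const[of "-1" S], of f] by (simp add: MConst_def single_uminus)

lemma adjoin_diff: "f \<in> adjoin S \<Longrightarrow> g \<in> adjoin S \<Longrightarrow> f - g \<in> adjoin S"
  using adjoin_add[of f S "- g"] adjoin_uminus[of g S] by simp

lemma adjoin_power: "f \<in> adjoin S \<Longrightarrow> f ^ k \<in> adjoin S"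
  by (induction k) (auto intro: adjoin_mult)

lemma adjoin_of_nat: "of_nat k \<in> adjoin S"
  by (induction k) (auto intro: adjoin_add)

lemma adjoin_sum: "(\<And>i. i \<in> I \<Longrightarrow> f i \<in> adjoin S) \<Longrightarrow> sum f I \<in> adjoin S"
  by (induction I rule: infinite_finite_induct) (auto intro: adjoin_add)

lemma adjoin_prod: "(\<And>i. i \<in> I \<Longrightarrow> f i \<in> adjoin S) \<Longrightarrow> prod f I \<in> adjoin S"
  by (induction I rule: infinite_finite_induct) (auto intro: adjoin_mult)

lemma adjoin_subset:
  assumes "S \<subseteq> adjoin S'"
  shows "adjoin S \<subseteq> adjoin S'"
proof
  fix f
  assume "f \<in> adjoin S"
  then show "f \<in> adjoin S'"
    by induction (use assms in \<open>auto intro: adjoin_const adjoin_add adjoin_mult\<close>)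
qed

lemma adjoin_mono: "S \<subseteq> S' \<Longrightarrow> adjoin S \<subseteq> adjoin S'"
  by (rule adjoin_subset) (auto intro: adjoin_gen)

text \<open>The coefficients lie in a subring but keep the type of the whole field, so that such a
  polynomial can be evaluated at any rational function and its roots can be counted.\<close>

definition polys_over :: "'n::{finite,linorder} ratfun set \<Rightarrow> 'n ratfun poly set" where
  "polys_over S = {p. \<forall>k. coeff p k \<in> adjoin S}"

lemma polys_overD: "p \<in> polys_over S \<Longrightarrow> coeff p k \<in> adjoin S"
  by (simp add: polys_over_def)

lemma polys_over_0 [simp]: "0 \<in> polys_over S"
  by (simp add: polys_over_def)

lemma polys_over_pCons_iff: "pCons a p \<in> polys_over S \<longleftrightarrow> a \<in> adjoin S \<and> p \<in> polys_over S"
  by (auto simp: polys_over_def coeff_pCons split: nat.splits)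

lemma polys_over_monom: "a \<in> adjoin S \<Longrightarrow> monom a k \<in> polys_over S"
  by (simp add: polys_over_def)

lemma polys_over_add: "p \<in> polys_over S \<Longrightarrow> q \<in> polys_over S \<Longrightarrow> p + q \<in> polys_over S"
  by (simp add: polys_over_def adjoin_add)

lemma polys_over_diff: "p \<in> polys_over S \<Longrightarrow> q \<in> polys_over S \<Longrightarrow> p - q \<in> polys_over S"
  by (simp add: polys_over_def adjoin_diff)

lemma polys_over_mult: "p \<in> polys_over S \<Longrightarrow> q \<in> polys_over S \<Longrightarrow> p * q \<in> polys_over S"
  by (auto simp: polys_over_def coeff_mult intro!: adjoin_sum adjoin_mult)

lemma polys_over_smult: "a \<in> adjoin S \<Longrightarrow> p \<in> polys_over S \<Longrightarrow> smult a p \<in> polys_over S"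
  by (simp add: polys_over_def adjoin_mult)

lemma polys_over_power: "p \<in> polys_over S \<Longrightarrow> p ^ k \<in> polys_over S"
  by (induction k) (auto intro: polys_over_mult simp: one_pCons polys_over_pCons_iff)

lemma polys_over_sum: "(\<And>i. i \<in> I \<Longrightarrow> f i \<in> polys_over S) \<Longrightarrow> sum f I \<in> polys_over S"
  by (induction I rule: infinite_finite_induct) (auto intro: polys_over_add)

section \<open>Expansion in powers of one variable, and transcendence\<close>

context
  fixes s :: "'n::{finite,linorder}"
begin

abbreviation coeff_ring :: "'n ratfun set" where
  "coeff_ring \<equiv> adjoin (X ` (- {s}))"

text \<open>Such an element is built from constants and the \<open>X i\<close> with \<open>i\<close>
  different from \<open>s\<close>, none of which notices the value at \<open>s\<close>. A single
  \<open>b\<close> serves all \<open>q\<close>, as specialising \<open>X s\<close> requires.\<close>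

lemma coeff_ring_msubst:
  assumes "a \<in> coeff_ring"
  shows "\<exists>b. to_fract b = a \<and> (\<forall>q. msubst (X(s := q)) b = a)"
  using assms
proof induction
  case (adjoin_const c)
  then show ?case
    by (metis msubst_MConst)
next
  case (adjoin_gen f)
  then obtain i where "i \<noteq> s" "f = X i"
    by auto
  then show ?case
    by (intro exI[of _ "MVar i"]) (auto simp: X_def)
next
  case (adjoin_add f g)
  then show ?case
    by (metis msubst_add to_fract_add)
next
  case (adjoin_mult f g)
  then show ?case
    by (metis msubst_mult to_fract_mult)
qed

lemma rsubst_update_coeff: "a \<in> coeff_ring \<Longrightarrow> rsubst (X(s := q)) a = a"
  using coeff_ring_msubst rsubst_to_fract by metis

text \<open>This collects \<open>T\<close> by powers of the variable at \<open>s\<close>. Since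
  \<open>p\<close> does not depend on \<open>q\<close>, the choice \<open>q = X s\<close> gives back
  \<open>T\<close> itself.\<close>

lemma msubst_update_eq_poly:
  "\<exists>p \<in> polys_over (X ` (- {s})). \<forall>q. msubst (X(s := q)) T = poly p q"
proof (induction T rule: poly_mapping_single_add_induct)
  case zero
  show ?case
    by (rule bexI[of _ 0]) simp_all
next
  case (single v c)
  define a where "a = to_fract (MConst c) * (\<Prod>i\<in>-{s}. X i ^ Poly_Mapping.lookup v i)"
  have a: "a \<in> coeff_ring"
    unfolding a_def
    by (intro adjoin_mult adjoin_const adjoin_prod adjoin_power adjoin_gen) auto
  have "msubst (X(s := q)) (Poly_Mapping.single v c) = poly (monom a (Poly_Mapping.lookup v s)) q" for q
  proof -
    have "(\<Prod>i\<in>UNIV. (X(s := q)) i ^ Poly_Mapping.lookup v i)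
        = q ^ Poly_Mapping.lookup v s * (\<Prod>i\<in>-{s}. (X(s := q)) i ^ Poly_Mapping.lookup v i)"
      by (subst prod.remove[of _ s]) (auto simp: Compl_eq_Diff_UNIV)
    also have "(\<Prod>i\<in>-{s}. (X(s := q)) i ^ Poly_Mapping.lookup v i)
        = (\<Prod>i\<in>-{s}. X i ^ Poly_Mapping.lookup v i)"
      by (intro prod.cong) auto
    finally show ?thesis
      by (simp add: msubst_single a_def poly_monom)
  qed
  with a show ?case
    by (blast intro: polys_over_monom)
next
  case (add p q)
  then show ?case
    by (metis msubst_add poly_add polys_over_add)
qed

text \<open>A relation for \<open>X s\<close> is the vanishing of a genuine polynomial
  \<open>M\<close>. Substituting any \<open>q\<close> for \<open>X s\<close> in \<open>M = 0\<close>
  makes every \<open>q\<close> a root of \<open>p\<close>, while the field is infinite.\<close>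

lemma X_transcendental:
  assumes p: "p \<in> polys_over (X ` (- {s}))" and 0: "poly p (X s) = 0"
  shows "p = 0"
proof -
  have "\<forall>k. \<exists>b. to_fract b = coeff p k \<and> (\<forall>q. msubst (X(s := q)) b = coeff p k)"
    using p by (intro allI coeff_ring_msubst polys_overD)
  then obtain b where b: "\<And>k. to_fract (b k) = coeff p k" "\<And>k q. msubst (X(s := q)) (b k) = coeff p k"
    by metis
  define M where "M = (\<Sum>k\<le>degree p. b k * MVar s ^ k)"
  have "to_fract M = poly p (X s)"
    by (simp add: M_def to_fract_sum to_fract_power b poly_altdef flip: X_def)
  with 0 have "M = 0"
    by simp
  have "poly p q = msubst (X(s := q)) M" for q
    by (simp add: M_def msubst_sum b poly_altdef)
  with \<open>M = 0\<close> have "{q. poly p q = 0} = UNIV"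
    by auto
  then show "p = 0"
    by (metis infinite_ratfun poly_roots_finite)
qed

text \<open>A relation among the entries of the tuple is a polynomial relation for \<open>q\<close>
  over the ring generated by the other variables, so transcendence of \<open>q\<close> over that
  ring suffices.\<close>

lemma alg_independent_updateI:
  assumes "\<And>p. p \<in> polys_over (X ` (- {s})) \<Longrightarrow> poly p q = 0 \<Longrightarrow> p = 0"
  shows "alg_independent (X(s := q))"
  unfolding alg_independent_def
proof (intro allI impI)
  fix T
  assume T: "msubst (X(s := q)) T = 0"
  obtain p where p: "p \<in> polys_over (X ` (- {s}))" "\<And>q. msubst (X(s := q)) T = poly p q"
    using msubst_update_eq_poly by blast
  with T assms have "p = 0"
    by metis
  with p(2)[of "X s"] show "T = 0"
    by simp
qed

text \<open>The case \<open>e = 0\<close> serves the reflection and \<open>e = 1\<close> the trace.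
  A relation at \<open>X s\<close> would hold at every nonzero \<open>r\<close>, so the fraction
  would take only finitely many values, each at only finitely many \<open>r\<close>.\<close>

lemma alg_independent_fraction:
  assumes P: "P \<in> coeff_ring" "P \<noteq> 0" and e: "e \<in> coeff_ring"
  shows "alg_independent (X(s := (P + e * X s ^ 2) / X s))"
proof (rule alg_independent_updateI, rule ccontr)
  fix p
  assume p: "p \<in> polys_over (X ` (- {s}))" "poly p ((P + e * X s ^ 2) / X s) = 0" "p \<noteq> 0"
  define N where "N = degree p"
  \<comment> \<open>The polynomial \<open>[:P, 0, e:]\<close> is the numerator of the fraction; the
    factor \<open>r ^ N\<close> clears all denominators.\<close>
  define p' where "p' = (\<Sum>k\<le>N. monom (coeff p k) (N - k) * [:P, 0, e:] ^ k)"
  have p': "poly p' r = r ^ N * poly p ((P + e * r ^ 2) / r)" if "r \<noteq> 0" for r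
  proof -
    have *: "coeff p k * r ^ (N - k) * (P + r * (r * e)) ^ k
        = r ^ N * (coeff p k * ((P + e * r ^ 2) / r) ^ k)" if "k \<le> N" for k
      using that \<open>r \<noteq> 0\<close>
      by (simp add: power_diff power_divide power2_eq_square mult_ac)
    then show ?thesis
      unfolding p'_def poly_altdef[of p] N_def[symmetric]
      by (simp add: poly_sum poly_monom sum_distrib_left) (intro sum.cong refl *, simp)
  qed
  have "p' \<in> polys_over (X ` (- {s}))"
    unfolding p'_def using p(1) P(1) e
    by (intro polys_over_sum polys_over_mult polys_over_monom polys_over_power polys_overD)
      (simp_all add: polys_over_pCons_iff)
  moreover have "poly p' (X s) = 0"
    using p(2) by (simp add: p')
  ultimately have "p' = 0"
    by (rule X_transcendental)
  \<comment> \<open>The fibre over a value \<open>t\<close> consists of roots of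
    \<open>[:P, - t, e:]\<close>, which is nonzero because its constant term is
    \<open>P\<close>.\<close>
  have "UNIV \<subseteq> {0} \<union> (\<Union>t\<in>{t. poly p t = 0}. {r. poly [:P, - t, e:] r = 0})"
  proof
    fix r :: "'n ratfun"
    have "poly [:P, - ((P + e * r ^ 2) / r), e:] r = 0" if "r \<noteq> 0"
      using that by (simp add: field_simps power2_eq_square)
    moreover have "poly p ((P + e * r ^ 2) / r) = 0" if "r \<noteq> 0"
      using p'[OF that] \<open>p' = 0\<close> that by simp
    ultimately show "r \<in> {0} \<union> (\<Union>t\<in>{t. poly p t = 0}. {r. poly [:P, - t, e:] r = 0})"
      by blast
  qed
  moreover have "finite ({0} \<union> (\<Union>t\<in>{t. poly p t = 0}. {r. poly [:P, - t, e:] r = 0}))"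
    using p(3) P(2) by (intro finite_UnI finite_UN_I poly_roots_finite) auto
  ultimately show False
    using infinite_ratfun finite_subset by blast
qed

section \<open>The reflection, its trace and its invariants\<close>

context
  fixes P :: "'n ratfun"
  assumes P: "P \<in> coeff_ring" "P \<noteq> 0"
begin

abbreviation reflection :: "'n \<Rightarrow> 'n ratfun" where
  "reflection \<equiv> X(s := P / X s)"

text \<open>This is the sum of \<open>X s\<close> and its conjugate \<open>P / X s\<close>, which
  the reflection exchanges.\<close>

abbreviation trace :: "'n ratfun" where
  "trace \<equiv> (P + X s ^ 2) / X s"

lemma alg_independent_reflection: "alg_independent reflection"
  using alg_independent_fraction[OF P, of 0] by simp

lemma alg_independent_trace: "alg_independent (X(s := trace))"
  using alg_independent_fraction[OF P, of 1] by simp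

lemmas reflection_hom =
  rsubst_0[OF alg_independent_reflection] rsubst_1[OF alg_independent_reflection]
  rsubst_add[OF alg_independent_reflection] rsubst_diff[OF alg_independent_reflection]
  rsubst_mult[OF alg_independent_reflection] rsubst_divide[OF alg_independent_reflection]
  rsubst_power[OF alg_independent_reflection] rsubst_powi[OF alg_independent_reflection]
  rsubst_inverse[OF alg_independent_reflection]
  rsubst_sum[OF alg_independent_reflection] rsubst_prod[OF alg_independent_reflection]

lemma reflection_trace: "rsubst reflection trace = trace"
  using P by (simp add: reflection_hom rsubst_update_coeff field_simps power2_eq_square)

lemma reflection_poly:
  assumes "p \<in> polys_over (X ` (- {s}))"
  shows "rsubst reflection (poly p (X s)) = poly p (P / X s)"
  using assms
  by (simp add: poly_altdef reflection_hom rsubst_update_coeff polys_overD)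

lemma reflection_involution: "rcomp reflection reflection = X"
  using P by (auto simp: rcomp_def reflection_hom rsubst_update_coeff)

text \<open>In terms of the Laurent coefficients \<open>f k = coeff p (k + m)\<close> of \<open>p / X\<^sub>s\<^sup>m\<close>,
  this is \<open>f (-k) = f k * P\<^sup>k\<close>, with \<open>k = m - j\<close> and both sides multiplied by \<open>P\<^sup>m\<close>.\<close>

lemma invariant_coeff:
  assumes p: "p \<in> polys_over (X ` (- {s}))"
    and inv: "rsubst reflection (poly p (X s) / X s ^ m) = poly p (X s) / X s ^ m"
  shows "P ^ m * coeff p j = (if j \<le> 2 * m then coeff p (2 * m - j) * P ^ (2 * m - j) else 0)"
proof -
  define N where "N = degree p"
  \<comment> \<open>Invariance reads
    \<open>P ^ m * poly p (X s) = poly p (P / X s) * X s ^ (2 * m)\<close>. Multiplying by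
    \<open>X s ^ N\<close> turns both sides into polynomials in \<open>X s\<close>, whose
    coefficients can then be compared.\<close>
  define lhs where "lhs = smult (P ^ m) (monom 1 N * p)"
  define rhs where "rhs = (\<Sum>k\<le>N. monom (coeff p k * P ^ k) (N + 2 * m - k))"
  have "poly p (P / X s) * X s ^ (2 * m) = P ^ m * poly p (X s)"
    using inv P by (simp add: reflection_hom reflection_poly[OF p] field_simps power_mult power2_eq_square)
  moreover have "poly rhs (X s) = X s ^ N * (poly p (P / X s) * X s ^ (2 * m))"
  proof -
    have *: "coeff p k * P ^ k * X s ^ (N + 2 * m - k)
        = X s ^ N * (coeff p k * (P / X s) ^ k * X s ^ (2 * m))" if "k \<le> N" for k
      using that by (simp add: power_diff power_divide power_add)
    then show ?thesis
      unfolding rhs_def poly_altdef[of p] N_def[symmetric]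
      by (simp add: poly_sum poly_monom sum_distrib_left sum_distrib_right)
        (intro sum.cong refl *, simp)
  qed
  ultimately have "poly (lhs - rhs) (X s) = 0"
    by (simp add: lhs_def poly_monom)
  moreover have "lhs - rhs \<in> polys_over (X ` (- {s}))"
    unfolding lhs_def rhs_def using p P(1)
    by (intro polys_over_diff polys_over_smult polys_over_mult polys_over_sum polys_over_monom
        adjoin_mult adjoin_power polys_overD) auto
  ultimately have "lhs = rhs"
    using X_transcendental by fastforce
  have "coeff lhs (N + j) = P ^ m * coeff p j"
    by (simp add: lhs_def coeff_monom_mult)
  \<comment> \<open>The exponents \<open>N + 2 * m - k\<close> and \<open>N + j\<close> agree only
    for \<open>k = 2 * m - j\<close>, with \<open>j\<close> at most \<open>2 * m\<close>.\<close>
  moreover have "coeff rhs (N + j) = (\<Sum>k\<le>N. if k = 2 * m - j \<and> j \<le> 2 * m then coeff p k * P ^ k else 0)"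
    unfolding rhs_def coeff_sum coeff_monom by (intro sum.cong) auto
  \<comment> \<open>If \<open>2 * m - j\<close> exceeds \<open>N\<close>, the sum is empty of
    nonzero terms and the coefficient of \<open>p\<close> is zero as well.\<close>
  moreover have "\<dots> = (if j \<le> 2 * m then coeff p (2 * m - j) * P ^ (2 * m - j) else 0)"
    by (cases "j \<le> 2 * m") (auto simp: N_def coeff_eq_0)
  ultimately show ?thesis
    using \<open>lhs = rhs\<close> by simp
qed

text \<open>Subtracting the multiple \<open>f m * trace\<^sup>m\<close> removes the extreme Laurent coefficients \<open>f m\<close> and \<open>f (-m)\<close>.\<close>

lemma invariant_in_adjoin_trace:
  assumes "p \<in> polys_over (X ` (- {s}))"
    and "rsubst reflection (poly p (X s) / X s ^ m) = poly p (X s) / X s ^ m"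
  shows "poly p (X s) / X s ^ m \<in> adjoin ({trace} \<union> X ` (- {s}))"
  using assms
proof (induction m arbitrary: p)
  case 0
  have "coeff p j = 0" if "j > 0" for j
    using invariant_coeff[OF 0, of j] that by simp
  then have "p = [:coeff p 0:]"
    by (intro poly_eqI) (simp add: coeff_pCons split: nat.splits)
  then have "poly p (X s) = coeff p 0"
    by (metis mult_zero_right poly_0 poly_pCons add.right_neutral)
  moreover have "coeff_ring \<subseteq> adjoin ({trace} \<union> X ` (- {s}))"
    by (rule adjoin_mono) auto
  ultimately show ?case
    using polys_overD[OF 0(1), of 0] by auto
next
  case (Suc m)
  \<comment> \<open>Dividing by \<open>X s ^ Suc m\<close> shifts indices, so \<open>c\<close> is
    the Laurent coefficient of \<open>X s ^ Suc m\<close>.\<close>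
  define c where "c = coeff p (2 * Suc m)"
  have c: "c \<in> coeff_ring"
    unfolding c_def by (rule polys_overD[OF Suc.prems(1)])
  \<comment> \<open>Over \<open>X s ^ Suc m\<close>, the power of \<open>[:P, 0, 1:]\<close> becomes
    \<open>trace ^ Suc m\<close>.\<close>
  define p' where "p' = p - smult c ([:P, 0, 1:] ^ Suc m)"
  have "P ^ Suc m * coeff p 0 = c * P ^ (2 * Suc m)"
    using invariant_coeff[OF Suc.prems, of 0] by (simp add: c_def)
  also have "P ^ (2 * Suc m) = P ^ Suc m * P ^ Suc m"
    by (simp only: mult_2 power_add)
  finally have "coeff p 0 = c * P ^ Suc m"
    using P(2) by (simp add: mult.left_commute[of c] del: power_Suc)
  then have "coeff p' 0 = 0"
    by (simp add: p'_def coeff_0_power del: power_Suc)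
  \<comment> \<open>With the constant term gone, one factor \<open>X s\<close> cancels and the
    induction hypothesis for \<open>m\<close> applies.\<close>
  then obtain p'' where p'': "p' = pCons 0 p''"
    by (metis coeff_pCons_0 pCons_cases)
  have "p' \<in> polys_over (X ` (- {s}))"
    unfolding p'_def using Suc.prems(1) c P(1)
    by (intro polys_over_diff polys_over_smult polys_over_power) (simp_all add: polys_over_pCons_iff)
  then have "p'' \<in> polys_over (X ` (- {s}))"
    by (simp add: p'' polys_over_pCons_iff)
  have "poly p'' (X s) / X s ^ m = poly p' (X s) / X s ^ Suc m"
    by (simp add: p'')
  also have "\<dots> = poly p (X s) / X s ^ Suc m - c * trace ^ Suc m"
    by (simp add: p'_def diff_divide_distrib power_divide power2_eq_square del: power_Suc)
  finally have eq: "poly p'' (X s) / X s ^ m = poly p (X s) / X s ^ Suc m - c * trace ^ Suc m" .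
  have "rsubst reflection (poly p'' (X s) / X s ^ m) = poly p'' (X s) / X s ^ m"
    unfolding eq
    by (simp only: rsubst_diff[OF alg_independent_reflection] rsubst_mult[OF alg_independent_reflection]
        rsubst_power[OF alg_independent_reflection] reflection_trace rsubst_update_coeff[OF c] Suc.prems(2))
  then have "poly p'' (X s) / X s ^ m \<in> adjoin ({trace} \<union> X ` (- {s}))"
    using \<open>p'' \<in> _\<close> by (rule Suc.IH[rotated])
  moreover have "c \<in> adjoin ({trace} \<union> X ` (- {s}))"
    using c adjoin_mono[of "X ` (- {s})" "{trace} \<union> X ` (- {s})"] by auto
  moreover have "trace ^ Suc m \<in> adjoin ({trace} \<union> X ` (- {s}))"
    by (rule adjoin_power, rule adjoin_gen) simp
  ultimately show ?case
    using adjoin_add adjoin_mult eq by (metis diff_add_cancel)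
qed

lemma invariant_over_power_in_adjoin_trace:
  assumes "rsubst reflection (to_fract T / X s ^ m) = to_fract T / X s ^ m"
  shows "to_fract T / X s ^ m \<in> adjoin ({trace} \<union> X ` (- {s}))"
proof -
  obtain p where "p \<in> polys_over (X ` (- {s}))" "\<And>q. msubst (X(s := q)) T = poly p q"
    using msubst_update_eq_poly by blast
  moreover from this(2)[of "X s"] have "to_fract T = poly p (X s)"
    by simp
  ultimately show ?thesis
    using assms invariant_in_adjoin_trace by simp
qed

text \<open>For negative \<open>k\<close> the power of \<open>X s\<close> moves into the numerator,
  which leaves pole order 0.\<close>

lemma invariant_over_powi_in_adjoin_trace:
  assumes "rsubst reflection (to_fract T / X s powi k) = to_fract T / X s powi k"
  shows "to_fract T / X s powi k \<in> adjoin ({trace} \<union> X ` (- {s}))"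
proof (cases "k \<ge> 0")
  case True
  then show ?thesis
    using invariant_over_power_in_adjoin_trace[of T "nat k"] assms by (simp add: power_int_def)
next
  case False
  then have "to_fract T / X s powi k = to_fract (T * MVar s ^ nat (- k)) / X s ^ 0"
    by (simp add: power_int_def to_fract_power X_def divide_inverse flip: power_inverse)
  then show ?thesis
    using invariant_over_power_in_adjoin_trace[of "T * MVar s ^ nat (- k)" 0] assms by simp
qed

text \<open>An involution generates only itself and the identity. Uniqueness of its inverse is
  checked by solving \<open>rcomp reflection h = X\<close> for \<open>h\<close>.\<close>

lemma generate_reflection: "generate birational_group {reflection} = {X, reflection}"
proof
  have refl_carrier: "reflection \<in> carrier birational_group"
    using alg_independent_reflection reflection_involution
    by (auto simp: birational_group_def)
  have inv: "inv\<^bsub>birational_group\<^esub> reflection = reflection"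
    unfolding m_inv_def
  proof (rule the_equality)
    fix h
    assume h: "h \<in> carrier birational_group \<and> reflection \<otimes>\<^bsub>birational_group\<^esub> h = \<one>\<^bsub>birational_group\<^esub>
      \<and> h \<otimes>\<^bsub>birational_group\<^esub> reflection = \<one>\<^bsub>birational_group\<^esub>"
    then have ind: "alg_independent h" and "rcomp reflection h = X"
      by (auto simp: birational_group_def)
    then have h_i: "rsubst h (reflection i) = X i" for i
      by (metis rcomp_def)
    \<comment> \<open>For \<open>i\<close> different from \<open>s\<close>, the entry
      \<open>reflection i\<close> is \<open>X i\<close>, which \<open>rsubst h\<close> sends to
      \<open>h i\<close>.\<close>
    have h_eq: "h = X(s := h s)"
    proof
      show "h i = (X(s := h s)) i" for i
        using h_i[of i] by auto
    qed
    have "P / h s = X s"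
      using h_i[of s] rsubst_update_coeff[OF P(1), of "h s"] rsubst_divide[OF ind] h_eq by simp
    \<comment> \<open>Division by zero yields 0 here, so \<open>h s = 0\<close> would force
      \<open>X s = 0\<close>.\<close>
    moreover from this have "h s \<noteq> 0"
      by force
    ultimately have "h s = P / X s"
      by (simp add: field_simps)
    with h_eq show "h = reflection"
      by simp
  qed (use refl_carrier reflection_involution in \<open>simp add: birational_group_def\<close>)
  have mult_eq: "g \<otimes>\<^bsub>birational_group\<^esub> h = rcomp g h" "rcomp X h = h" "rcomp g X = g"
    for g h :: "'n \<Rightarrow> 'n ratfun"
    by (simp_all add: birational_group_def rcomp_def)
  show "generate birational_group {reflection} \<subseteq> {X, reflection}"
  proof
    fix h
    assume "h \<in> generate birational_group {reflection}"
    then show "h \<in> {X, reflection}"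
    proof induction
      case (eng h1 h2)
      then show ?case
        using reflection_involution by (elim insertE emptyE) (simp_all add: mult_eq del: fun_upd_apply)
    qed (auto simp: inv, simp add: birational_group_def)
  qed
  show "{X, reflection} \<subseteq> generate birational_group {reflection}"
    using generate.one[of birational_group "{reflection}"] generate.incl[of reflection]
    by (auto simp: birational_group_def)
qed

end

end

section \<open>Laurent polynomials and exchange polynomials\<close>

text \<open>Monomial denominators multiply to a common one. The fraction may be unreduced, so
  natural exponents suffice and \<open>F = 0\<close> is included, unlike in
  \<open>of_type\<close>.\<close>

lemma laurent_polys_cases:
  assumes "F \<in> laurent_polys"
  obtains T v where "F = to_fract T / (\<Prod>i\<in>UNIV. X i ^ v i)"
proof -
  have "\<exists>T v. F = to_fract T / (\<Prod>i\<in>UNIV. X i ^ v i)"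
    using assms unfolding laurent_polys_def
  proof induction
    case (adjoin_const c)
    show ?case
      by (rule exI[of _ "MConst c"], rule exI[of _ "\<lambda>_. 0"]) simp
  next
    case (adjoin_gen f)
    then consider i where "f = X i" | i where "f = inverse (X i)"
      by blast
    then show ?case
    proof cases
      case 1
      then show ?thesis
        by (intro exI[of _ "MVar i"] exI[of _ "\<lambda>_. 0"]) (simp add: X_def)
    next
      case 2
      have "(\<Prod>j\<in>UNIV. X j ^ (if j = i then 1 else 0)) = (\<Prod>j\<in>UNIV. if j = i then X j else 1)"
        by (intro prod.cong) auto
      with 2 show ?thesis
        by (intro exI[of _ 1] exI[of _ "\<lambda>j. if j = i then 1 else 0"]) (simp add: divide_inverse)
    qed
  next
    case (adjoin_add f g)
    then obtain T v U w where "f = to_fract T / (\<Prod>i\<in>UNIV. X i ^ v i)" "g = to_fract U / (\<Prod>i\<in>UNIV. X i ^ w i)"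
      by blast
    moreover have "(\<Prod>i\<in>UNIV. X i ^ v i) = to_fract (\<Prod>i\<in>UNIV. MVar i ^ v i)" for v :: "'a \<Rightarrow> nat"
      by (simp add: to_fract_prod to_fract_power X_def)
    ultimately have "f + g = to_fract (T * (\<Prod>i\<in>UNIV. MVar i ^ w i) + U * (\<Prod>i\<in>UNIV. MVar i ^ v i))
        / (\<Prod>i\<in>UNIV. X i ^ (v i + w i))"
      by (simp add: power_add prod.distrib add_frac_eq)
    then show ?case
      by (intro exI)
  next
    case (adjoin_mult f g)
    then obtain T v U w where "f = to_fract T / (\<Prod>i\<in>UNIV. X i ^ v i)" "g = to_fract U / (\<Prod>i\<in>UNIV. X i ^ w i)"
      by blast
    then have "f * g = to_fract (T * U) / (\<Prod>i\<in>UNIV. X i ^ (v i + w i))"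
      by (simp add: power_add prod.distrib)
    then show ?case
      by (intro exI)
  qed
  with that show thesis
    by blast
qed

text \<open>Setting all variables to 1 leaves the sum of the coefficients of \<open>Zpoly\<close>,
  which is positive because its constant coefficient is, and the field has characteristic 0.\<close>

lemma exchange_poly_nonzero:
  assumes "seedlet_at s \<omega>"
  shows "exchange_poly \<omega> \<noteq> 0"
proof
  assume "exchange_poly \<omega> = 0"
  then have "msubst (\<lambda>_. 1) (exchange_poly \<omega>) = 0"
    by simp
  then have "(of_nat (\<Sum>i\<le>rdeg \<omega>. coeff (Zpoly \<omega>) i) :: 'a ratfun) = 0"
    by (simp add: exchange_poly_def msubst_sum msubst_prod)
  then have "(\<Sum>i\<le>rdeg \<omega>. coeff (Zpoly \<omega>) i) = 0"
    by (simp only: of_nat_ratfun_eq_0_iff)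
  with assms show False
    by (auto simp: seedlet_at_def)
qed

text \<open>Since \<open>bvec\<close> vanishes at \<open>s\<close>, the variable at \<open>s\<close>
  occurs only with exponent 0.\<close>

lemma exchange_poly_in_coeff_ring:
  assumes "seedlet_at s \<omega>"
  shows "to_fract (exchange_poly \<omega>) \<in> adjoin (X ` (- {s}))"
proof -
  have "to_fract (MVar j) ^ (i * nat (bvec \<omega> j) + (rdeg \<omega> - i) * nat (- bvec \<omega> j))
      \<in> adjoin (X ` (- {s}))" for i j
    using assms adjoin_power[OF adjoin_gen, of "X j" "X ` (- {s})"]
    by (cases "j = s") (auto simp: seedlet_at_def simp flip: X_def)
  then show ?thesis
    unfolding exchange_poly_def
    by (auto simp: to_fract_sum to_fract_prod to_fract_power to_fract_of_nat
        intro!: adjoin_sum adjoin_mult adjoin_of_nat adjoin_prod)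
qed

section \<open>The invariant ring of a cluster symmetric map\<close>

theorem proposition2p25:
  fixes s :: "'n::{finite,linorder}" and \<omega> :: "'n seedlet"
  assumes "seedlet_at s \<omega>"
  shows "(\<forall>F T \<eta> d.
            F \<in> invariant_ring (generate birational_group {cluster_sym_map s \<omega>}) \<and> of_type F T \<eta> d
            \<longrightarrow> to_fract T / X s powi d s \<in> adjoin ({basic_invariant s \<omega>} \<union> X ` (- {s}))) \<and>
         invariant_ring (generate birational_group {cluster_sym_map s \<omega>}) =
           adjoin ({basic_invariant s \<omega>} \<union> X ` (- {s}) \<union> (\<lambda>i. inverse (X i)) ` (- {s})) \<and>
         alg_independent (X(s := basic_invariant s \<omega>))"
proof -
  define P where "P = to_fract (exchange_poly \<omega>)"
  define \<psi> where "\<psi> = X(s := P / X s)"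
  define y where "y = (P + X s ^ 2) / X s"
  let ?I = "invariant_ring (generate birational_group {cluster_sym_map s \<omega>})"
  let ?B = "adjoin ({y} \<union> X ` (- {s}))"
  let ?C = "adjoin ({y} \<union> X ` (- {s}) \<union> (\<lambda>i. inverse (X i)) ` (- {s}))"
  have P: "P \<in> adjoin (X ` (- {s}))" "P \<noteq> 0"
    using exchange_poly_in_coeff_ring[OF assms] exchange_poly_nonzero[OF assms] by (simp_all add: P_def)
  have ind: "alg_independent \<psi>"
    unfolding \<psi>_def by (rule alg_independent_reflection[OF P])
  have X_fixed: "\<psi> i = X i" if "i \<noteq> s" for i
    using that by (simp add: \<psi>_def)
  have y_eq: "basic_invariant s \<omega> = y"
    by (simp add: basic_invariant_def y_def P_def)
  have I_iff: "F \<in> ?I \<longleftrightarrow> F \<in> laurent_polys \<and> rsubst \<psi> F = F" for F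
  proof -
    have "generate birational_group {cluster_sym_map s \<omega>} = {X, \<psi>}"
      using generate_reflection[OF P] by (simp add: cluster_sym_map_def \<psi>_def P_def)
    then show ?thesis
      by (auto simp: invariant_ring_def)
  qed
  have part1: "to_fract T / X s powi d s \<in> ?B" if F: "F \<in> ?I" "of_type F T \<eta> d" for F T \<eta> d
  proof -
    \<comment> \<open>Multiplying \<open>F\<close> by the powers of the other variables, all fixed
      by \<open>\<psi>\<close>, leaves an invariant whose denominator involves only
      \<open>X s\<close>.\<close>
    have "(\<Prod>i\<in>UNIV. X i powi d i) = X s powi d s * (\<Prod>i\<in>-{s}. X i powi d i)"
      by (subst prod.remove[of _ s]) (auto simp: Compl_eq_Diff_UNIV)
    then have "to_fract T / X s powi d s = F * (\<Prod>i\<in>-{s}. X i powi d i)"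
      using F(2) by (simp add: of_type_def)
    moreover have "rsubst \<psi> (F * (\<Prod>i\<in>-{s}. X i powi d i)) = F * (\<Prod>i\<in>-{s}. X i powi d i)"
      using F(1) by (simp add: I_iff rsubst_mult[OF ind] rsubst_prod[OF ind] rsubst_powi[OF ind] X_fixed
          cong: prod.cong_simp)
    ultimately have "rsubst \<psi> (to_fract T / X s powi d s) = to_fract T / X s powi d s"
      by (simp only:)
    then show ?thesis
      unfolding y_def \<psi>_def by (rule invariant_over_powi_in_adjoin_trace[OF P])
  qed
  have "?I \<subseteq> ?C"
  proof
    fix F
    assume F: "F \<in> ?I"
    then have "F \<in> laurent_polys"
      by (simp add: I_iff)
    then obtain T v where T: "F = to_fract T / (\<Prod>i\<in>UNIV. X i ^ v i)"
      by (rule laurent_polys_cases)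
    \<comment> \<open>\<open>M\<close> clears the denominator away from \<open>s\<close>; its
      inverse, available in \<open>?C\<close>, restores \<open>F\<close> at the end.\<close>
    define M where "M = (\<Prod>i\<in>-{s}. X i ^ v i)"
    have "M \<noteq> 0"
      by (simp add: M_def)
    have "(\<Prod>i\<in>UNIV. X i ^ v i) = X s ^ v s * M"
      unfolding M_def by (subst prod.remove[of _ s]) (auto simp: Compl_eq_Diff_UNIV)
    then have FM: "to_fract T / X s ^ v s = F * M"
      using T \<open>M \<noteq> 0\<close> by simp
    moreover have "rsubst \<psi> (F * M) = F * M"
      using F by (simp add: M_def I_iff rsubst_mult[OF ind] rsubst_prod[OF ind] rsubst_power[OF ind] X_fixed
          cong: prod.cong_simp)
    ultimately have "rsubst \<psi> (to_fract T / X s ^ v s) = to_fract T / X s ^ v s"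
      by (simp only:)
    then have "to_fract T / X s ^ v s \<in> ?B"
      unfolding y_def \<psi>_def by (rule invariant_over_power_in_adjoin_trace[OF P])
    then have "F * M \<in> ?B"
      by (simp only: FM)
    moreover have "?B \<subseteq> ?C"
      by (rule adjoin_mono) auto
    moreover have "(\<Prod>i\<in>-{s}. inverse (X i) ^ v i) \<in> ?C"
      by (rule adjoin_prod, rule adjoin_power, rule adjoin_gen) auto
    then have "inverse M \<in> ?C"
      by (simp add: M_def power_inverse comp_def flip: prod_inversef)
    ultimately have "F * M * inverse M \<in> ?C"
      by (blast intro: adjoin_mult)
    then show "F \<in> ?C"
      using \<open>M \<noteq> 0\<close> by (simp add: mult.assoc)
  qed
  have "?C \<subseteq> ?I"
  proof
    fix F
    assume "F \<in> ?C"
    have "rsubst \<psi> y = y"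
      unfolding y_def \<psi>_def by (rule reflection_trace[OF P])
    have "rsubst \<psi> F = F"
      using \<open>F \<in> ?C\<close>
    proof induction
      case (adjoin_gen f)
      with \<open>rsubst \<psi> y = y\<close> show ?case
        by (auto simp: rsubst_inverse[OF ind] intro: X_fixed)
    qed (simp_all add: rsubst_add[OF ind] rsubst_mult[OF ind])
    moreover have "?C \<subseteq> laurent_polys"
    proof -
      have X: "X i \<in> laurent_polys" "inverse (X i) \<in> laurent_polys" for i :: 'n
        unfolding laurent_polys_def by (auto intro: adjoin_gen)
      have "adjoin (X ` (- {s})) \<subseteq> laurent_polys"
        unfolding laurent_polys_def by (rule adjoin_mono) auto
      \<comment> \<open>This is \<open>y\<close> written with \<open>inverse (X s)\<close>, which
        makes it visibly a Laurent polynomial.\<close>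
      with P have "(P + X s ^ 2) * inverse (X s) \<in> laurent_polys"
        using X[of s] unfolding laurent_polys_def
        by (blast intro: adjoin_add adjoin_mult adjoin_power)
      with X show ?thesis
        unfolding laurent_polys_def by (intro adjoin_subset) (auto simp: y_def divide_inverse)
    qed
    ultimately show "F \<in> ?I"
      using \<open>F \<in> ?C\<close> by (auto simp: I_iff)
  qed
  have "?I = ?C"
    using \<open>?I \<subseteq> ?C\<close> \<open>?C \<subseteq> ?I\<close> by (rule equalityI)
  moreover have "alg_independent (X(s := y))"
    unfolding y_def by (rule alg_independent_trace[OF P])
  ultimately show ?thesis
    using part1 unfolding y_eq by blast
qed

end
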